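(* For every $n\ge1$, for all large enough $s$ we have $k(s,n)\ge s/f(n)$.
   Context: A tropical polynomial over $\mathbb{Q}$ in $\vec{x}=(x_1,\dots,x_n)$ is a finite collection of tropical monomials $m_J(\vec{x}) = c_J + j_1x_1+\dots+j_nx_n$ with pairwise distinct exponent vectors $J=(j_1,\dots,j_n)$ and constants $c_J\in\mathbb{Q}$; its value is $p(\vec{x})=\max_J m_J(\vec{x})$. Here the exponents are allowed to be arbitrary rational numbers. A polynomial is nontrivial if it has at least one monomial. A point $\vec{a}\in\mathbb{Q}^n$ is a root of $p$ if the maximum $\max_J m_J(\vec{a})$ is attained on at least two distinct monomials. $k(s,n)$ denotes the minimal number such that for any set $S$ of $s$ points in $\mathbb{Q}^n$ there is a nontrivial tropical polynomial over $\mathbb{Q}$ in $n$ variables with at most $k(s,n)$ monomials having roots in all the points of $S$. $f(n)$ is the maximal number such that any large enough finite set $S$ of points in $n$-dimensional space ($S\subseteq\mathbb{Q}^n$) contains a set of $f(n)$ points that lie on the boundary of some bounded convex polyhedron (possibly degenerate) while there are no other points of $S$ in the interior of this polyhedron; boundary and interior are taken in the ambient $n$-dimensional space. It is known (Valtr, 1992) that $f(n)$ is finite, at most factorial in $n$. *)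

theory Defs
  imports "HOL-Analysis.Analysis" "HOL-Library.Extended_Nat" "HOL-Library.Extended_Real"
begin

text \<open>A monomial is a pair of its exponent vector and its constant, and a tropical polynomial is
  its set of monomials. The number of variables is the cardinality of the index type.\<close>

type_synonym 'n monomial = "(rat ^ 'n) \<times> rat"

definition monomial_value :: "'n::finite monomial \<Rightarrow> rat ^ 'n \<Rightarrow> rat" where
  "monomial_value m x = snd m + (\<Sum>i\<in>UNIV. fst m $ i * x $ i)"

definition tropical_polynomial :: "'n::finite monomial set \<Rightarrow> bool" where
  "tropical_polynomial p \<longleftrightarrow> finite p \<and> inj_on fst p"

definition tropical_value :: "'n::finite monomial set \<Rightarrow> rat ^ 'n \<Rightarrow> rat" where
  "tropical_value p x = Max ((\<lambda>m. monomial_value m x) ` p)"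

definition tropical_root :: "'n::finite monomial set \<Rightarrow> rat ^ 'n \<Rightarrow> bool" where
  "tropical_root p a \<longleftrightarrow>
     (\<exists>m\<in>p. \<exists>m'\<in>p. m \<noteq> m' \<and> monomial_value m a = tropical_value p a
                        \<and> monomial_value m' a = tropical_value p a)"

text \<open>The minimum exists: for any \<open>s\<close> points, a polynomial in a single coordinate
  with at most \<open>s + 1\<close> monomials has roots at all of them.\<close>

definition k_trop :: "'n::finite itself \<Rightarrow> nat \<Rightarrow> nat" where
  "k_trop _ s = (LEAST k. \<forall>S :: (rat ^ 'n) set. finite S \<and> card S = s \<longrightarrow>
     (\<exists>p. tropical_polynomial p \<and> p \<noteq> {} \<and> card p \<le> k \<and> (\<forall>a\<in>S. tropical_root p a)))"

definition real_point :: "rat ^ 'n \<Rightarrow> real ^ 'n" where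
  "real_point x = (\<chi> i. of_rat (x $ i))"

text \<open>Frontier and interior are those of the ambient space, so a polyhedron that is not
  full-dimensional is its own frontier and has empty interior.\<close>

definition on_empty_polyhedron :: "(rat ^ 'n::finite) set \<Rightarrow> (rat ^ 'n) set \<Rightarrow> bool" where
  "on_empty_polyhedron S T \<longleftrightarrow>
     (\<exists>P :: (real ^ 'n) set. polyhedron P \<and> bounded P \<and>
        real_point ` T \<subseteq> frontier P \<and> real_point ` (S - T) \<inter> interior P = {})"

text \<open>The supremum is taken in the extended naturals so that the definition does not presuppose
  Valtr's theorem. By that theorem it is finite, and hence a maximum.\<close>

definition f_empty :: "'n::finite itself \<Rightarrow> enat" where
  "f_empty _ = Sup {enat m | m. \<exists>N. \<forall>S :: (rat ^ 'n) set. finite S \<and> N \<le> card S \<longrightarrow>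
     (\<exists>T\<subseteq>S. card T = m \<and> on_empty_polyhedron S T)}"

end

theory Submission
  imports Defs
begin

text \<open>
  Call a subset \<open>T\<close> of \<open>S\<close> hollow if no point of \<open>S\<close> is interior to the convex hull of \<open>T\<close>.
  This is the same as lying on an empty bounded polyhedron (\<open>on_empty_polyhedron_iff_hull\<close>), since
  any such polyhedron can be shrunk to the hull of \<open>T\<close>. The lower bound comes from the cells of
  linearity of a polynomial \<open>p\<close> that has roots at all points of \<open>S\<close>. On the cell of a monomial
  \<open>m\<close>, the set where \<open>m\<close> attains the maximum, a root is a point where some other monomial
  ties with \<open>m\<close>, so it cannot be interior to the cell. As the cell is convex, the points of \<open>S\<close> in it
  form a hollow set (\<open>maximizer_cell_hollow\<close>). The cells cover \<open>S\<close>, so if hollow subsets of \<open>S\<close>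
  have at most \<open>F\<close> points, then \<open>card S \<le> card p * F\<close>.

  Suppose \<open>f(n) = F\<close> is finite. Then there are arbitrarily large sets \<open>S\<close> without hollow
  subsets of size \<open>F + 1\<close>. The bound on \<open>k(s,n)\<close> needs such a set of size exactly \<open>s\<close>. Passing to
  an arbitrary subset could create new hollow sets, but discarding a vertex of the convex
  hull does not, because a vertex lies in no hull of other points. So vertices are
  discarded until \<open>s\<close> points remain (\<open>shrink_without_hollow_subsets\<close>). For infinite \<open>f(n)\<close> the bound
  reads \<open>k(s,n) \<ge> 0\<close>.
\<close>

section \<open>Empty polyhedra as convex hulls\<close>

lemma inj_real_point: "inj real_point"
  by (auto simp: inj_on_def real_point_def vec_eq_iff)

lemma on_empty_polyhedron_iff_hull:
  fixes S T :: "(rat ^ 'n::finite) set"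
  assumes "finite S" "T \<subseteq> S"
  shows "on_empty_polyhedron S T \<longleftrightarrow>
    real_point ` S \<inter> interior (convex hull (real_point ` T)) = {}"
proof
  assume "on_empty_polyhedron S T"
  then obtain P :: "(real ^ 'n) set" where P: "polyhedron P"
    "real_point ` T \<subseteq> frontier P" "real_point ` (S - T) \<inter> interior P = {}"
    unfolding on_empty_polyhedron_def by blast
  have "frontier P \<subseteq> P"
    using P(1) by (simp add: frontier_subset_closed polyhedron_imp_closed)
  then have "convex hull (real_point ` T) \<subseteq> P"
    using P by (intro hull_minimal) (auto simp: polyhedron_imp_convex)
  then have "interior (convex hull (real_point ` T)) \<subseteq> interior P"
    by (rule interior_mono)
  moreover have "real_point ` T \<inter> interior P = {}"
    using P(2) by (auto simp: frontier_def)
  ultimately show "real_point ` S \<inter> interior (convex hull (real_point ` T)) = {}"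
    using P(3) by blast
next
  assume *: "real_point ` S \<inter> interior (convex hull (real_point ` T)) = {}"
  have fin: "finite (real_point ` T)"
    using assms finite_subset by blast
  then have "closed (convex hull (real_point ` T))"
    by (simp add: compact_imp_closed finite_imp_compact_convex_hull)
  moreover have "real_point ` T \<subseteq> convex hull (real_point ` T)"
    by (rule hull_subset)
  ultimately have "real_point ` T \<subseteq> frontier (convex hull (real_point ` T))"
    using * assms(2) by (auto simp: frontier_def)
  moreover have "polyhedron (convex hull (real_point ` T))" "bounded (convex hull (real_point ` T))"
    using fin by (simp_all add: polyhedron_convex_hull finite_imp_bounded bounded_convex_hull)
  ultimately show "on_empty_polyhedron S T"
    unfolding on_empty_polyhedron_def using *
    by (intro exI[of _ "convex hull (real_point ` T)"]) auto
qed

lemma on_empty_polyhedron_subset: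
  fixes S T T' :: "(rat ^ 'n::finite) set"
  assumes "finite S" "T \<subseteq> S" "on_empty_polyhedron S T" "T' \<subseteq> T"
  shows "on_empty_polyhedron S T'"
proof -
  have "interior (convex hull (real_point ` T')) \<subseteq> interior (convex hull (real_point ` T))"
    using assms(4) by (intro interior_mono hull_mono image_mono)
  then show ?thesis
    using assms on_empty_polyhedron_iff_hull[of S T] on_empty_polyhedron_iff_hull[of S T'] by blast
qed

lemma on_empty_polyhedron_singleton:
  fixes S :: "(rat ^ 'n::finite) set"
  assumes "finite S" "x \<in> S"
  shows "on_empty_polyhedron S {x}"
  using assms on_empty_polyhedron_iff_hull[of S "{x}"] by simp

text \<open>The bound needs this: if \<open>f(n)\<close> were \<open>0\<close>, the quotient \<open>s / f(n)\<close> would be infinite for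
  \<open>s > 0\<close>. A single point is a degenerate polyhedron with empty interior.\<close>

lemma one_le_f_empty: "1 \<le> f_empty TYPE('n::finite)"
proof -
  have "\<exists>T\<subseteq>S. card T = 1 \<and> on_empty_polyhedron S T"
    if "finite S" "1 \<le> card S" for S :: "(rat ^ 'n) set"
  proof -
    have "S \<noteq> {}"
      using that(2) by auto
    then obtain x where "x \<in> S"
      by blast
    then show ?thesis
      using on_empty_polyhedron_singleton that by (intro exI[of _ "{x}"]) auto
  qed
  then have "enat 1 \<le> f_empty TYPE('n)"
    unfolding f_empty_def by (intro Sup_upper) blast
  then show ?thesis
    by (simp add: one_enat_def)
qed

section \<open>Point sets without large empty polyhedra\<close>

text \<open>Take for \<open>v\<close> an extreme point of the hull of \<open>S\<close>. Deleting it leaves that hull convex, so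
  the hull of the other points misses \<open>v\<close>: putting \<open>v\<close> back never fills a hollow set.\<close>

lemma remove_hull_vertex:
  fixes S :: "(rat ^ 'n::finite) set"
  assumes "finite S" "S \<noteq> {}"
  obtains v where "v \<in> S"
    "\<And>T. T \<subseteq> S - {v} \<Longrightarrow> on_empty_polyhedron (S - {v}) T \<Longrightarrow> on_empty_polyhedron S T"
proof -
  let ?H = "convex hull (real_point ` S)"
  have "compact ?H" "convex ?H" "?H \<noteq> {}"
    using assms by (auto simp: finite_imp_compact_convex_hull)
  then obtain w where w: "w extreme_point_of ?H"
    using extreme_point_exists_convex by blast
  then have "w \<in> real_point ` S"
    by (rule extreme_point_of_convex_hull)
  then obtain v where v: "v \<in> S" "w = real_point v"
    by blast
  have "convex (?H - {w})"
    using w extreme_point_of_stillconvex \<open>convex ?H\<close> by blast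
  moreover have "real_point ` (S - {v}) \<subseteq> ?H - {w}"
    using v inj_real_point hull_subset[of "real_point ` S" convex] by (auto dest: injD)
  ultimately have sub: "convex hull (real_point ` (S - {v})) \<subseteq> ?H - {w}"
    by (intro hull_minimal)
  have "on_empty_polyhedron S T"
    if T: "T \<subseteq> S - {v}" "on_empty_polyhedron (S - {v}) T" for T
  proof -
    have "convex hull (real_point ` T) \<subseteq> convex hull (real_point ` (S - {v}))"
      using T(1) by (intro hull_mono image_mono)
    then have "w \<notin> interior (convex hull (real_point ` T))"
      using sub interior_subset by blast
    moreover have "real_point ` (S - {v}) \<inter> interior (convex hull (real_point ` T)) = {}"
      using T on_empty_polyhedron_iff_hull[of "S - {v}" T] assms(1) by simp
    ultimately have "real_point ` S \<inter> interior (convex hull (real_point ` T)) = {}"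
      using v(2) by blast
    then show ?thesis
      using T(1) on_empty_polyhedron_iff_hull[of S T] assms(1) by blast
  qed
  then show thesis
    using v(1) that by blast
qed

lemma shrink_without_hollow_subsets:
  fixes S :: "(rat ^ 'n::finite) set"
  assumes "finite S" "s \<le> card S" "\<nexists>T. T \<subseteq> S \<and> card T = m \<and> on_empty_polyhedron S T"
  obtains S' :: "(rat ^ 'n) set" where "finite S'" "card S' = s"
    "\<nexists>T. T \<subseteq> S' \<and> card T = m \<and> on_empty_polyhedron S' T"
  using assms
proof (induction "card S - s" arbitrary: S thesis)
  case 0
  then show ?case by auto
next
  case (Suc d)
  then have "S \<noteq> {}"
    by auto
  then obtain v where v: "v \<in> S"
    "\<And>T. T \<subseteq> S - {v} \<Longrightarrow> on_empty_polyhedron (S - {v}) T \<Longrightarrow> on_empty_polyhedron S T"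
    using remove_hull_vertex Suc.prems(2) by blast
  have "card (S - {v}) = card S - 1"
    using v(1) by (simp add: Suc.prems(2))
  then have "d = card (S - {v}) - s" "s \<le> card (S - {v})"
    using Suc.hyps(2) by auto
  moreover have "\<nexists>T. T \<subseteq> S - {v} \<and> card T = m \<and> on_empty_polyhedron (S - {v}) T"
    using v(2) Suc.prems(4) by blast
  ultimately show ?case
    using Suc.hyps(1)[of "S - {v}"] Suc.prems(1,2) by blast
qed

lemma exists_set_with_small_hollow_subsets:
  assumes "f_empty TYPE('n::finite) = enat F"
  obtains S :: "(rat ^ 'n) set" where "finite S" "card S = s"
    "\<And>T. T \<subseteq> S \<Longrightarrow> on_empty_polyhedron S T \<Longrightarrow> card T \<le> F"
proof -
  have "\<not> (\<exists>N. \<forall>S :: (rat ^ 'n) set. finite S \<and> N \<le> card S \<longrightarrow>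
      (\<exists>T\<subseteq>S. card T = Suc F \<and> on_empty_polyhedron S T))"
  proof
    assume "\<exists>N. \<forall>S :: (rat ^ 'n) set. finite S \<and> N \<le> card S \<longrightarrow>
      (\<exists>T\<subseteq>S. card T = Suc F \<and> on_empty_polyhedron S T)"
    then have "enat (Suc F) \<le> f_empty TYPE('n)"
      unfolding f_empty_def by (intro Sup_upper) blast
    then show False
      using assms by simp
  qed
  then obtain S0 :: "(rat ^ 'n) set" where "finite S0" "s \<le> card S0"
    "\<nexists>T. T \<subseteq> S0 \<and> card T = Suc F \<and> on_empty_polyhedron S0 T"
    by blast
  then obtain S :: "(rat ^ 'n) set" where S: "finite S" "card S = s"
    "\<nexists>T. T \<subseteq> S \<and> card T = Suc F \<and> on_empty_polyhedron S T"
    by (rule shrink_without_hollow_subsets)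
  have "card T \<le> F" if T: "T \<subseteq> S" "on_empty_polyhedron S T" for T
  proof (rule ccontr)
    assume "\<not> card T \<le> F"
    then obtain T' where "T' \<subseteq> T" "card T' = Suc F"
      using obtain_subset_with_card_n[of "Suc F" T] by auto
    then show False
      using S(1,3) T on_empty_polyhedron_subset by blast
  qed
  then show thesis
    using S that by blast
qed

section \<open>Cells of a tropical polynomial\<close>

lemma of_rat_monomial_value:
  "real_of_rat (monomial_value m x) =
    real_of_rat (snd m) + real_point (fst m) \<bullet> real_point x"
  by (simp add: monomial_value_def real_point_def inner_vec_def of_rat_add of_rat_sum of_rat_mult)

lemma monomial_value_le_tropical_value:
  assumes "finite p" "m \<in> p"
  shows "monomial_value m x \<le> tropical_value p x"
  using assms by (simp add: tropical_value_def)

text \<open>A root \<open>a\<close> inside the hull would have a monomial \<open>m' \<noteq> m\<close> attaining the maximum there. All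
  of \<open>T\<close> lies in the half-space \<open>m' \<le> m\<close>, whose interior is \<open>m' < m\<close> because the
  exponent vectors of \<open>m\<close> and \<open>m'\<close> differ; so \<open>m\<close> would exceed the maximum at \<open>a\<close>.\<close>

lemma maximizer_cell_hollow:
  fixes p :: "'n::finite monomial set"
  assumes p: "tropical_polynomial p" and S: "finite S" "\<And>a. a \<in> S \<Longrightarrow> tropical_root p a"
    and m: "m \<in> p"
  shows "on_empty_polyhedron S {a \<in> S. monomial_value m a = tropical_value p a}"
proof -
  let ?T = "{a \<in> S. monomial_value m a = tropical_value p a}"
  let ?H = "convex hull (real_point ` ?T)"
  have fin: "finite p"
    using p by (simp add: tropical_polynomial_def)
  have "real_point a \<notin> interior ?H" if a: "a \<in> S" for a
  proof
    assume int: "real_point a \<in> interior ?H"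
    obtain m' where m': "m' \<in> p" "m' \<noteq> m" "monomial_value m' a = tropical_value p a"
      using S(2)[OF a] unfolding tropical_root_def by metis
    have "fst m' \<noteq> fst m"
      using p m m' by (auto simp: tropical_polynomial_def dest: inj_onD)
    then have nz: "real_point (fst m') - real_point (fst m) \<noteq> 0"
      using inj_real_point by (auto dest: injD)
    define b where "b = real_of_rat (snd m) - real_of_rat (snd m')"
    let ?K = "{y. (real_point (fst m') - real_point (fst m)) \<bullet> y \<le> b}"
    have "real_point ` ?T \<subseteq> ?K"
    proof clarsimp
      fix x assume "monomial_value m x = tropical_value p x"
      then have "monomial_value m' x \<le> monomial_value m x"
        using monomial_value_le_tropical_value[OF fin m'(1)] by simp
      then have "real_of_rat (monomial_value m' x) \<le> real_of_rat (monomial_value m x)"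
        by (simp add: of_rat_less_eq)
      then show "(real_point (fst m') - real_point (fst m)) \<bullet> real_point x \<le> b"
        by (simp add: of_rat_monomial_value b_def inner_diff_left)
    qed
    then have "?H \<subseteq> ?K"
      by (intro hull_minimal convex_halfspace_le)
    then have "real_point a \<in> interior ?K"
      using int interior_mono by blast
    then have "(real_point (fst m') - real_point (fst m)) \<bullet> real_point a < b"
      using interior_halfspace_le[OF nz] by blast
    then have "real_of_rat (monomial_value m' a) < real_of_rat (monomial_value m a)"
      by (simp add: of_rat_monomial_value b_def inner_diff_left)
    then have "monomial_value m' a < monomial_value m a"
      by (simp add: of_rat_less)
    then show False
      using monomial_value_le_tropical_value[OF fin m, of a] m'(3) by simp
  qed
  then show ?thesis
    using on_empty_polyhedron_iff_hull[of S ?T] S(1) by blast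
qed

lemma card_roots_le:
  fixes p :: "'n::finite monomial set"
  assumes p: "tropical_polynomial p" and S: "finite S" "\<And>a. a \<in> S \<Longrightarrow> tropical_root p a"
    and F: "\<And>T. T \<subseteq> S \<Longrightarrow> on_empty_polyhedron S T \<Longrightarrow> card T \<le> F"
  shows "card S \<le> card p * F"
proof -
  let ?T = "\<lambda>m. {a \<in> S. monomial_value m a = tropical_value p a}"
  have "finite p"
    using p by (simp add: tropical_polynomial_def)
  have "S \<subseteq> (\<Union>m\<in>p. ?T m)"
    using S(2) by (fastforce simp: tropical_root_def)
  then have "card S \<le> card (\<Union>m\<in>p. ?T m)"
    using S(1) \<open>finite p\<close> by (intro card_mono) auto
  also have "\<dots> \<le> (\<Sum>m\<in>p. card (?T m))"
    by (rule card_UN_le[OF \<open>finite p\<close>])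
  also have "\<dots> \<le> card p * F"
    using F maximizer_cell_hollow[OF p S] by (intro sum_bounded_above[where K = F, simplified]) auto
  finally show ?thesis .
qed

section \<open>Existence of a polynomial with prescribed roots\<close>

text \<open>\<open>k_trop\<close> is a least element, so its defining property holds only once some bound is known
  to work for all \<open>S\<close>. Let \<open>V\<close> be the set of \<open>i\<close>-th coordinates of \<open>S\<close>. The function
  \<open>\<Sum>t\<in>V. max 0 (x $ i - t)\<close> is the maximum over \<open>A \<subseteq> V\<close> of the monomials \<open>\<Sum>t\<in>A. x $ i - t\<close>, and it
  breaks exactly at the elements of \<open>V\<close>. At \<open>x $ i = u\<close> the maximum is attained by the initial segments
  of \<open>V\<close> below \<open>u\<close> with and without \<open>u\<close>. Initial segments form a chain, so
  keeping only those makes the exponents \<open>card A\<close> pairwise distinct.\<close>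

lemma exists_polynomial_with_roots:
  fixes S :: "(rat ^ 'n::finite) set"
  assumes S: "finite S" "S \<noteq> {}"
  shows "\<exists>p. tropical_polynomial p \<and> p \<noteq> {} \<and> card p \<le> 2 * card S \<and> (\<forall>a\<in>S. tropical_root p a)"
proof -
  fix i :: 'n
  define V where "V = (\<lambda>a. a $ i) ` S"
  define D where "D = (\<lambda>u. {t \<in> V. t < u}) ` V \<union> (\<lambda>u. {t \<in> V. t \<le> u}) ` V"
  define mon :: "rat set \<Rightarrow> 'n monomial" where "mon A = (axis i (of_nat (card A)), - \<Sum>A)" for A
  define p where "p = mon ` D"
  have V: "finite V" "V \<noteq> {}" "card V \<le> card S"
    using S by (auto simp: V_def card_image_le)
  have sub: "A \<subseteq> V" "finite A" if "A \<in> D" for A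
    using that V(1) by (auto simp: D_def)
  have "finite D"
    using V by (simp add: D_def)
  have chain: "A \<subseteq> B \<or> B \<subseteq> A" if "A \<in> D" "B \<in> D" for A B
    using that by (auto simp: D_def)
  have eq: "A = B" if "A \<in> D" "B \<in> D" "card A = card B" for A B
    using chain[OF that(1,2)] card_subset_eq[of A B] card_subset_eq[of B A] sub that by auto
  have value_mon: "monomial_value (mon A) x = (\<Sum>t\<in>A. x $ i - t)" for A x
  proof -
    have "(\<Sum>j\<in>UNIV. axis i (rat_of_nat (card A)) $ j * x $ j) =
        (\<Sum>j\<in>UNIV. if j = i then of_nat (card A) * x $ i else 0)"
      by (intro sum.cong) (auto simp: axis_def)
    then show ?thesis
      by (simp add: monomial_value_def mon_def sum_subtractf)
  qed
  have upper: "monomial_value (mon A) x \<le> (\<Sum>t\<in>V. max 0 (x $ i - t))" if "A \<in> D" for A x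
  proof -
    have "monomial_value (mon A) x \<le> (\<Sum>t\<in>A. max 0 (x $ i - t))"
      unfolding value_mon by (intro sum_mono) simp
    also have "\<dots> \<le> (\<Sum>t\<in>V. max 0 (x $ i - t))"
      using sub[OF that] V by (intro sum_mono2) auto
    finally show ?thesis .
  qed
  have "mon A = mon B" if "A \<in> D" "B \<in> D" "fst (mon A) = fst (mon B)" for A B
  proof -
    have "card A = card B"
      using that(3) by (auto simp: mon_def axis_eq_axis)
    then show ?thesis
      using eq[OF that(1,2)] by simp
  qed
  then have "tropical_polynomial p"
    unfolding tropical_polynomial_def p_def
    using \<open>finite D\<close> by (auto simp: inj_on_def)
  moreover have "p \<noteq> {}"
    using V by (simp add: p_def D_def)
  moreover have "card p \<le> 2 * card S"
  proof -
    have "card p \<le> card D"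
      unfolding p_def by (rule card_image_le[OF \<open>finite D\<close>])
    also have "\<dots> \<le> card ((\<lambda>u. {t \<in> V. t < u}) ` V) + card ((\<lambda>u. {t \<in> V. t \<le> u}) ` V)"
      unfolding D_def by (rule card_Un_le)
    also have "\<dots> \<le> card V + card V"
      using V by (intro add_mono card_image_le)
    finally show ?thesis
      using V(3) by simp
  qed
  moreover have "tropical_root p a" if "a \<in> S" for a
  proof -
    define u where "u = a $ i"
    define A where "A = {t \<in> V. t < u}"
    define B where "B = {t \<in> V. t \<le> u}"
    have "u \<in> V"
      using that by (simp add: u_def V_def)
    then have AB: "A \<in> D" "B \<in> D"
      by (auto simp: A_def B_def D_def)
    have vA: "monomial_value (mon A) a = (\<Sum>t\<in>V. max 0 (a $ i - t))"
      unfolding value_mon A_def using V by (intro sum.mono_neutral_cong_left) (auto simp: u_def)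
    have vB: "monomial_value (mon B) a = (\<Sum>t\<in>V. max 0 (a $ i - t))"
      unfolding value_mon B_def using V by (intro sum.mono_neutral_cong_left) (auto simp: u_def)
    have max: "tropical_value p a = (\<Sum>t\<in>V. max 0 (a $ i - t))"
      unfolding tropical_value_def p_def using \<open>finite D\<close> AB(1) vA upper
      by (intro Max_eqI) (auto intro: rev_image_eqI)
    have "B = insert u A" "u \<notin> A" "finite A"
      using \<open>u \<in> V\<close> V by (auto simp: A_def B_def)
    then have "mon A \<noteq> mon B"
      by (auto simp: mon_def axis_eq_axis)
    then show ?thesis
      unfolding tropical_root_def using AB vA vB max by (auto simp: p_def)
  qed
  ultimately show ?thesis
    by blast
qed

lemma k_trop_works:
  fixes S :: "(rat ^ 'n::finite) set"
  assumes "finite S" "S \<noteq> {}"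
  shows "\<exists>p. tropical_polynomial p \<and> p \<noteq> {} \<and> card p \<le> k_trop TYPE('n) (card S) \<and>
    (\<forall>a\<in>S. tropical_root p a)"
proof -
  let ?works = "\<lambda>k. \<forall>S' :: (rat ^ 'n) set. finite S' \<and> card S' = card S \<longrightarrow>
     (\<exists>p. tropical_polynomial p \<and> p \<noteq> {} \<and> card p \<le> k \<and> (\<forall>a\<in>S'. tropical_root p a))"
  have "?works (2 * card S)"
  proof (intro allI impI)
    fix S' :: "(rat ^ 'n) set"
    assume S': "finite S' \<and> card S' = card S"
    then have "S' \<noteq> {}"
      using assms by auto
    then show "\<exists>p. tropical_polynomial p \<and> p \<noteq> {} \<and> card p \<le> 2 * card S \<and>
        (\<forall>a\<in>S'. tropical_root p a)"
      using exists_polynomial_with_roots[of S'] S' by simp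
  qed
  then have "?works (k_trop TYPE('n) (card S))"
    unfolding k_trop_def by (rule LeastI[of ?works])
  then show ?thesis
    using assms by blast
qed

section \<open>The lower bound\<close>

theorem corollary17:
  shows "\<forall>\<^sub>F s in sequentially.
    ereal (real (k_trop TYPE('n::finite) s)) \<ge> ereal (real s) / ereal_of_enat (f_empty TYPE('n))"
proof (cases "f_empty TYPE('n)")
  case infinity
  then show ?thesis
    by simp
next
  case (enat F)
  have "F \<ge> 1"
    using one_le_f_empty[where 'n = 'n] enat by (simp add: one_enat_def)
  have "ereal (real s) / ereal_of_enat (f_empty TYPE('n)) \<le> ereal (real (k_trop TYPE('n) s))"
    if "s \<ge> 1" for s
  proof -
    obtain S :: "(rat ^ 'n) set" where S: "finite S" "card S = s"
      "\<And>T. T \<subseteq> S \<Longrightarrow> on_empty_polyhedron S T \<Longrightarrow> card T \<le> F"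
      using exists_set_with_small_hollow_subsets[OF enat] by metis
    then have "S \<noteq> {}"
      using that by auto
    then obtain p where p: "tropical_polynomial p" "card p \<le> k_trop TYPE('n) s"
      "\<forall>a\<in>S. tropical_root p a"
      using k_trop_works[of S] S by blast
    have "s \<le> card p * F"
      using card_roots_le[of p S F] S p by blast
    also have "\<dots> \<le> k_trop TYPE('n) s * F"
      using p(2) by simp
    finally have "real s \<le> real (k_trop TYPE('n) s) * real F"
      by (metis of_nat_le_iff of_nat_mult)
    then show ?thesis
      using \<open>F \<ge> 1\<close> enat by (simp add: divide_le_eq)
  qed
  then show ?thesis
    by (rule eventually_sequentiallyI)
qed

end
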